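(* Let $n\ge 2$ be an integer and let $A,B,C,D$ be the blocks defined in the context (each in its defined location). Then the blocks $A,B,C,D$ are pairwise equivalent under compositions of rotations and translations of $\mathbb{R}^4$; that is, for any two of these blocks there is a composition of rotations and translations of $\mathbb{R}^4$ mapping the first block onto the second.
   Context: Coordinates on $\mathbb{R}^4$ are $(x,y,z,w)$. For integers $a,b,c,d$, the unit cube with location label $(a,b,c,d)$ is the set $\{(x,y,z,w): a-1\le x\le a,\ b-1\le y\le b,\ c-1\le z\le c,\ d-1\le w\le d\}$. A block is a union of unit cubes, described by its set of location labels. For a fixed integer $n\ge 2$, the blocks (in their defined locations) are the unions of the unit cubes with labels in the following sets: $A=\{(x,y,z,w): 1\le i\le n,\ z=i,\ x,y,w\in\{1,\dots,i\}\}$; $B=\{(x,y,z,w): 1\le i\le n,\ y=i+1,\ x,z,w\in\{1,\dots,i\}\}$; $C=\{(x,y,z,w): 1\le i\le n,\ x=i+1,\ y\in\{2,\dots,i+1\},\ z,w\in\{1,\dots,i\}\}$; $D=\{(x,y,z,w): 1\le i\le n,\ w=i,\ x,y\in\{1,\dots,i\},\ z\in\{0,\dots,i-1\}\}$. Each block consists of $1^3+2^3+\cdots+n^3$ unit cubes. *)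

theory Defs
  imports "HOL-Analysis.Analysis"
begin

(* The coordinates x, y, z, w of a point p of R^4 are p $ 1, p $ 2, p $ 3, p $ 4. *)

type_synonym label = "int \<times> int \<times> int \<times> int"

fun unit_cube :: "label \<Rightarrow> (real ^ 4) set" where
  "unit_cube (a, b, c, d) =
     {p. real_of_int (a - 1) \<le> p $ 1 \<and> p $ 1 \<le> real_of_int a \<and>
         real_of_int (b - 1) \<le> p $ 2 \<and> p $ 2 \<le> real_of_int b \<and>
         real_of_int (c - 1) \<le> p $ 3 \<and> p $ 3 \<le> real_of_int c \<and>
         real_of_int (d - 1) \<le> p $ 4 \<and> p $ 4 \<le> real_of_int d}"

definition block :: "label set \<Rightarrow> (real ^ 4) set" where
  "block L = (\<Union>l\<in>L. unit_cube l)"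

definition labels_A :: "int \<Rightarrow> label set" where
  "labels_A n = {(x, y, z, w). \<exists>i. 1 \<le> i \<and> i \<le> n \<and>
     z = i \<and> x \<in> {1..i} \<and> y \<in> {1..i} \<and> w \<in> {1..i}}"

definition labels_B :: "int \<Rightarrow> label set" where
  "labels_B n = {(x, y, z, w). \<exists>i. 1 \<le> i \<and> i \<le> n \<and>
     y = i + 1 \<and> x \<in> {1..i} \<and> z \<in> {1..i} \<and> w \<in> {1..i}}"

definition labels_C :: "int \<Rightarrow> label set" where
  "labels_C n = {(x, y, z, w). \<exists>i. 1 \<le> i \<and> i \<le> n \<and>
     x = i + 1 \<and> y \<in> {2..i + 1} \<and> z \<in> {1..i} \<and> w \<in> {1..i}}"

definition labels_D :: "int \<Rightarrow> label set" where
  "labels_D n = {(x, y, z, w). \<exists>i. 1 \<le> i \<and> i \<le> n \<and>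
     w = i \<and> x \<in> {1..i} \<and> y \<in> {1..i} \<and> z \<in> {0..i - 1}}"

definition block_A :: "int \<Rightarrow> (real ^ 4) set" where "block_A n = block (labels_A n)"
definition block_B :: "int \<Rightarrow> (real ^ 4) set" where "block_B n = block (labels_B n)"
definition block_C :: "int \<Rightarrow> (real ^ 4) set" where "block_C n = block (labels_C n)"
definition block_D :: "int \<Rightarrow> (real ^ 4) set" where "block_D n = block (labels_D n)"

(* rotation_matrix demands determinant 1, so reflections are excluded. Rotations about
   the origin suffice as generators: those about another centre arise by composing
   with translations. *)
inductive rot_trans :: "(real ^ 4 \<Rightarrow> real ^ 4) \<Rightarrow> bool" where
  rotation: "rotation_matrix Q \<Longrightarrow> rot_trans (\<lambda>p. Q *v p)"
| translation: "rot_trans (\<lambda>p. p + t)"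
| composition: "rot_trans f \<Longrightarrow> rot_trans g \<Longrightarrow> rot_trans (f \<circ> g)"

definition rot_trans_equivalent :: "(real ^ 4) set \<Rightarrow> (real ^ 4) set \<Rightarrow> bool" where
  "rot_trans_equivalent S T \<longleftrightarrow> (\<exists>f. rot_trans f \<and> f ` S = T)"

end

theory Submission
  imports Defs
begin

text \<open>Block \<open>A\<close> is symmetric in \<open>x\<close>, \<open>y\<close>, \<open>w\<close>. Up to a translation, each other block arises from it
  by a transposition of the \<open>z\<close>-axis with another one, which has determinant \<open>-1\<close>; composing with a
  transposition of two of the symmetric axes turns it into a 3-cycle of the axes, hence into a rotation.\<close>

text \<open>Induction over the generators: a rotation is undone by its transpose, a translation by
  the opposite one, a composition by the inverses in reverse order.\<close>

lemma rot_trans_inverse: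
  assumes "rot_trans f"
  shows "\<exists>g. rot_trans g \<and> g \<circ> f = id"
  using assms
proof induction
  case (rotation Q)
  then have "rotation_matrix (transpose Q)" and "transpose Q ** Q = mat 1"
    by (auto simp: rotation_matrix_def orthogonal_matrix_def)
  then show ?case
    by (intro exI[of _ "\<lambda>p. transpose Q *v p"])
      (auto simp: fun_eq_iff matrix_vector_mul_assoc rot_trans.rotation simp del: transpose_matrix_vector)
next
  case (translation t)
  show ?case
    by (intro exI[of _ "\<lambda>p. p + - t"]) (simp add: fun_eq_iff rot_trans.translation del: add_uminus_conv_diff)
next
  case (composition f g)
  then obtain f' g' where "rot_trans f'" "f' \<circ> f = id" "rot_trans g'" "g' \<circ> g = id"
    by blast
  then show ?case
    by (intro exI[of _ "g' \<circ> f'"] conjI rot_trans.composition) (simp_all add: fun_eq_iff)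
qed

lemma rot_trans_equivalent_sym:
  assumes "rot_trans_equivalent S T"
  shows "rot_trans_equivalent T S"
proof -
  obtain f where f: "rot_trans f" "f ` S = T"
    using assms by (auto simp: rot_trans_equivalent_def)
  obtain g where g: "rot_trans g" "g \<circ> f = id"
    using rot_trans_inverse[OF f(1)] by blast
  have "g ` T = S"
    using f(2) g(2) by (metis image_comp image_id id_apply)
  with g(1) show ?thesis
    by (auto simp: rot_trans_equivalent_def)
qed

lemma rot_trans_equivalent_trans:
  assumes "rot_trans_equivalent S T" "rot_trans_equivalent T U"
  shows "rot_trans_equivalent S U"
  using assms unfolding rot_trans_equivalent_def by (metis rot_trans.composition image_comp)

text \<open>Permuting the rows of the identity keeps them orthonormal and multiplies the determinant
  by the sign of \<open>\<pi>\<close>.\<close>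

lemma rotation_matrix_even_permutation:
  fixes \<pi> :: "'n::finite \<Rightarrow> 'n"
  assumes "\<pi> permutes UNIV" "evenperm \<pi>"
  shows "rotation_matrix (\<chi> i. (mat 1 :: real^'n^'n) $ \<pi> i)"
proof -
  let ?Q = "\<chi> i. (mat 1 :: real^'n^'n) $ \<pi> i"
  have "?Q ** transpose ?Q = mat 1"
    using permutes_inj[OF assms(1)]
    by (auto simp: matrix_matrix_mult_def transpose_def mat_def vec_eq_iff inj_eq mult_delta_left)
  then have "orthogonal_matrix ?Q"
    by (simp add: orthogonal_matrix matrix_left_right_inverse)
  moreover have "det ?Q = 1"
    using assms by (simp add: det_permute_rows sign_def)
  ultimately show ?thesis
    by (simp add: rotation_matrix_def)
qed

definition three_cycle :: "'a \<Rightarrow> 'a \<Rightarrow> 'a \<Rightarrow> 'a \<Rightarrow> 'a" where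
  "three_cycle a b c i = (if i = a then b else if i = b then c else if i = c then a else i)"

lemma three_cycle_permutes_even:
  fixes a b c :: "'a::finite"
  assumes "distinct [a, b, c]"
  shows "three_cycle a b c permutes UNIV" "evenperm (three_cycle a b c)"
proof -
  have *: "three_cycle a b c = Transposition.transpose a b \<circ> Transposition.transpose b c"
    using assms by (auto simp: fun_eq_iff three_cycle_def Transposition.transpose_def)
  show "three_cycle a b c permutes UNIV"
    unfolding * by (intro permutes_compose permutes_swap_id) auto
  show "evenperm (three_cycle a b c)"
    using assms unfolding * by (simp add: evenperm_comp permutation_swap_id evenperm_swap)
qed

text \<open>Coordinates are pulled back along the cycle: the new \<open>a\<close>-coordinate is the
  old \<open>b\<close>-coordinate, and so on.\<close>

lemma rot_trans_three_cycle:
  fixes t :: "real ^ 4"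
  assumes "distinct [a, b, c]"
  shows "rot_trans (\<lambda>p. (\<chi> i. p $ three_cycle a b c i) + t)"
proof -
  let ?Q = "\<chi> i. (mat 1 :: real^4^4) $ three_cycle a b c i"
  have "rot_trans ((\<lambda>p. p + t) \<circ> (\<lambda>p. ?Q *v p))"
    using three_cycle_permutes_even[OF assms]
    by (intro rot_trans.intros rotation_matrix_even_permutation)
  moreover have "?Q *v p = (\<chi> i. p $ three_cycle a b c i)" for p
    by (simp add: matrix_vector_mult_def mat_def vec_eq_iff mult_delta_left)
  ultimately show ?thesis
    by (simp add: o_def)
qed

text \<open>Reduces the equivalence of blocks to a membership test on one generic cube, which is
  linear arithmetic for a concrete \<open>f\<close>.\<close>

lemma rot_trans_equivalent_block_image:
  assumes "rot_trans f"
    and "\<And>a b c d p. f p \<in> unit_cube (g (a, b, c, d)) \<longleftrightarrow> p \<in> unit_cube (a, b, c, d)"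
  shows "rot_trans_equivalent (block L) (block (g ` L))"
proof -
  have cube: "f p \<in> unit_cube (g l) \<longleftrightarrow> p \<in> unit_cube l" for l p
    using assms(2) by (cases l) blast
  obtain h where h: "rot_trans h" "h \<circ> f = id"
    using rot_trans_inverse[OF assms(1)] by blast
  \<comment> \<open>Here \<open>k = k \<circ> h \<circ> f = f\<close>, so \<open>h\<close> is also a
    right inverse of \<open>f\<close>. This gives the surjectivity needed to cover all of
    \<open>unit_cube (g l)\<close>.\<close>
  obtain k where "k \<circ> h = id"
    using rot_trans_inverse[OF h(1)] by blast
  with h(2) have "f (h q) = q" for q
    by (metis comp_apply id_apply)
  then have "q \<in> f ` unit_cube l" if "q \<in> unit_cube (g l)" for q l
    using that cube by (metis imageI)
  then have "f ` unit_cube l = unit_cube (g l)" for l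
    using cube by blast
  then have "f ` block L = block (g ` L)"
    by (simp add: block_def image_UN)
  with assms(1) show ?thesis
    by (auto simp: rot_trans_equivalent_def)
qed

text \<open>The layer index \<open>z = i\<close> of \<open>A\<close> must become
  \<open>y = i + 1\<close>, hence the entry \<open>z + 1\<close>; the symmetry of \<open>A\<close>
  allows \<open>x\<close> and \<open>y\<close> to fill the other two places so that the axes undergo
  a 3-cycle.\<close>

lemma labels_B_eq: "labels_B n = (\<lambda>(x, y, z, w). (y, z + 1, x, w)) ` labels_A n"
proof -
  have "(x, y, z, w) \<in> labels_B n \<longleftrightarrow> (z, x, y - 1, w) \<in> labels_A n" for x y z w
    by (auto simp: labels_A_def labels_B_def intro: exI[of _ "y - 1"])
  then show ?thesis by (force simp: image_iff)
qed

text \<open>Two shifts occur: the layer index becomes \<open>x = i + 1\<close>, and \<open>y\<close>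
  ranges over \<open>{2..i + 1}\<close>.\<close>

lemma labels_C_eq: "labels_C n = (\<lambda>(x, y, z, w). (z + 1, x + 1, y, w)) ` labels_A n"
proof -
  have "(x, y, z, w) \<in> labels_C n \<longleftrightarrow> (y - 1, z, x - 1, w) \<in> labels_A n" for x y z w
    by (auto simp: labels_A_def labels_C_def intro: exI[of _ "x - 1"])
  then show ?thesis by (force simp: image_iff)
qed

text \<open>The layer index moves to \<open>w\<close> unshifted; the entry \<open>y - 1\<close>
  accounts for the range \<open>{0..i - 1}\<close> of \<open>z\<close>.\<close>

lemma labels_D_eq: "labels_D n = (\<lambda>(x, y, z, w). (x, w, y - 1, z)) ` labels_A n"
proof -
  have "(x, y, z, w) \<in> labels_D n \<longleftrightarrow> (x, z + 1, w, y) \<in> labels_A n" for x y z w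
    by (auto simp: labels_A_def labels_D_def)
  then show ?thesis by (force simp: image_iff)
qed

text \<open>Every label uses the same convention \<open>[a - 1, a]\<close> on each axis and no axis
  is reversed, so points and labels transform by the same formula: the cycle permutes the entries
  and the translation vector collects the shifts.\<close>

lemma block_A_equivalent_B: "rot_trans_equivalent (block_A n) (block_B n)"
  unfolding block_A_def block_B_def labels_B_eq
  by (rule rot_trans_equivalent_block_image[OF rot_trans_three_cycle[of 1 2 3 "axis 2 1"]])
    (simp_all add: three_cycle_def axis_def algebra_simps conj_ac)

lemma block_A_equivalent_C: "rot_trans_equivalent (block_A n) (block_C n)"
  unfolding block_A_def block_C_def labels_C_eq
  by (rule rot_trans_equivalent_block_image[OF rot_trans_three_cycle[of 1 3 2 "axis 1 1 + axis 2 1"]])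
    (simp_all add: three_cycle_def axis_def algebra_simps conj_ac)

lemma block_A_equivalent_D: "rot_trans_equivalent (block_A n) (block_D n)"
  unfolding block_A_def block_D_def labels_D_eq
  by (rule rot_trans_equivalent_block_image[OF rot_trans_three_cycle[of 2 4 3 "- axis 3 1"]])
    (simp_all add: three_cycle_def axis_def algebra_simps conj_ac)

theorem theorem4:
  fixes n :: int
  assumes "n \<ge> 2"
  shows "\<forall>S \<in> {block_A n, block_B n, block_C n, block_D n}.
         \<forall>T \<in> {block_A n, block_B n, block_C n, block_D n}. rot_trans_equivalent S T"
proof -
  \<comment> \<open>Reflexivity comes from going to \<open>block_B n\<close> and back;
    \<open>block_A n\<close> then links any two blocks.\<close>
  have "rot_trans_equivalent (block_A n) (block_A n)"
    using block_A_equivalent_B rot_trans_equivalent_sym rot_trans_equivalent_trans by blast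
  then have "rot_trans_equivalent (block_A n) S"
    if "S \<in> {block_A n, block_B n, block_C n, block_D n}" for S
    using that block_A_equivalent_B block_A_equivalent_C block_A_equivalent_D by blast
  then show ?thesis
    by (meson rot_trans_equivalent_sym rot_trans_equivalent_trans)
qed

end
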